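(* Let $X$ be a Banach space, let $Y\subseteq X$ be a half-space, and let $\mathfrak A\subseteq L(X)$ be an algebra of operators. Suppose that there exists a finite-dimensional subspace $F\subseteq X$ such that $TY\subseteq Y+F$ for every $T\in\mathfrak A$. Then there exists a half-space of $X$ that is invariant under every operator in $\mathfrak A$.
   Context: $L(X)$ denotes the algebra of bounded linear operators on $X$. An algebra of operators is a subalgebra of $L(X)$, not assumed to be norm closed. A half-space of $X$ is a norm closed linear subspace of $X$ of infinite dimension and infinite codimension. A closed subspace $Z$ is invariant under $T$ if $TZ\subseteq Z$. *)

theory Defs
  imports "HOL-Analysis.Analysis"
begin

text \<open>
  Banach spaces over the real or the complex numbers, treated uniformly. The class \<^class>\<open>banach\<close>
  supplies the norm, its completeness and the underlying real structure; the scalar multiplication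
  over the ground field \<open>'k\<close> is the parameter \<open>scale\<close>. Up to isomorphism, the only instances of
  \<^class>\<open>real_normed_field\<close> are the real and the complex numbers (Gelfand-Mazur).
\<close>

locale banach_space_over = vector_space scale
  for scale :: "'k::real_normed_field \<Rightarrow> 'x::banach \<Rightarrow> 'x" +
  assumes scale_of_real: "scale (of_real r) x = r *\<^sub>R x"
    and norm_scale: "norm (scale c x) = norm c * norm x"
begin

definition finite_dim_subspace :: "'x set \<Rightarrow> bool" where
  "finite_dim_subspace V \<longleftrightarrow> (\<exists>B. finite B \<and> V = span B)"

text \<open>The quotient of the space by \<open>V\<close> is spanned by the cosets of finitely many vectors.\<close>

definition finite_codim :: "'x set \<Rightarrow> bool" where
  "finite_codim V \<longleftrightarrow> (\<exists>B. finite B \<and> (\<forall>x. \<exists>b\<in>span B. x - b \<in> V))"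

definition half_space :: "'x set \<Rightarrow> bool" where
  "half_space Y \<longleftrightarrow>
     subspace Y \<and> closed Y \<and> \<not> finite_dim_subspace Y \<and> \<not> finite_codim Y"

definition bounded_operators :: "('x \<Rightarrow> 'x) set" where
  "bounded_operators = {T. Vector_Spaces.linear scale scale T \<and> bounded_linear T}"

text \<open>Neither a unit nor closedness in the operator norm is required.\<close>

definition operator_algebra :: "('x \<Rightarrow> 'x) set \<Rightarrow> bool" where
  "operator_algebra A \<longleftrightarrow>
     A \<subseteq> bounded_operators \<and>
     (\<lambda>x. 0) \<in> A \<and>
     (\<forall>S\<in>A. \<forall>T\<in>A. (\<lambda>x. S x + T x) \<in> A) \<and>
     (\<forall>c. \<forall>T\<in>A. (\<lambda>x. scale c (T x)) \<in> A) \<and>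
     (\<forall>S\<in>A. \<forall>T\<in>A. S \<circ> T \<in> A)"

end

definition invariant_under :: "('x \<Rightarrow> 'x) \<Rightarrow> 'x set \<Rightarrow> bool" where
  "invariant_under T Z \<longleftrightarrow> T ` Z \<subseteq> Z"

lemma banach_space_over_real: "banach_space_over (scaleR :: real \<Rightarrow> 'x::banach \<Rightarrow> 'x)"
  by unfold_locales (auto simp: algebra_simps)

lemma banach_space_over_complex: "banach_space_over ((*) :: complex \<Rightarrow> complex \<Rightarrow> complex)"
  by unfold_locales (auto simp: algebra_simps norm_mult scaleR_conv_of_real)

lemma bounded_operators_real:
  "banach_space_over.bounded_operators (scaleR :: real \<Rightarrow> 'x::banach \<Rightarrow> 'x) = Collect bounded_linear"
  unfolding banach_space_over.bounded_operators_def[OF banach_space_over_real]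
  using bounded_linear.linear linear_def by blast

end

(* Z = span (Y \<union> \<Union>T\<in>A. T ` Y) is invariant because A is closed under composition, and
   Y \<subseteq> Z \<subseteq> Y + F shows that Z is a finite-dimensional extension of Y; hence Z is again of infinite
   dimension and codimension. That such an extension is closed needs the scalar field to be complete,
   which is not assumed: by Gelfand-Mazur it is the reals or the complex numbers.

   Gelfand-Mazur is proved through the multiplicativity of the norm. Let m be the minimum over complex
   z of the norm of Q z = c^2 - 2 Re z c + |z|^2, and suppose m > 0. Factoring over the complex
   numbers, a monic real polynomial p has |p(c)|^2 \<ge> m ^ degree p. If |Q z| = m, then Q z + e divides
   (Q z)^n - (-e)^n with a monic cofactor, so |Q z + e| \<le> m (1 + (e/m)^n), which gives |Q z + e| = m
   for 0 < e < m. As Q z + e is again of the form Q z', iterating the step makes the constant term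
   arbitrarily large while the norm stays m, a contradiction. *)

theory Submission
  imports Defs "HOL-Computational_Algebra.Fundamental_Theorem_Algebra"
begin

section \<open>Real polynomials with coefficients carried into another algebra\<close>

lemma map_poly_of_real_mult:
  "map_poly of_real (p * q) =
    (map_poly of_real p * map_poly of_real q :: 'a::{real_algebra_1,comm_ring_1} poly)"
  by (rule poly_eqI) (simp add: coeff_map_poly coeff_mult)

lemma map_poly_of_real_add:
  "map_poly of_real (p + q) =
    (map_poly of_real p + map_poly of_real q :: 'a::{real_algebra_1,comm_ring_1} poly)"
  by (rule poly_eqI) (simp add: coeff_map_poly)

lemma map_poly_of_real_power:
  "map_poly of_real (p ^ n) = (map_poly of_real p ^ n :: 'a::{real_algebra_1,comm_ring_1} poly)"
  by (induction n) (simp_all add: map_poly_of_real_mult)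

lemma map_poly_cnj_mult: "map_poly cnj (p * q) = map_poly cnj p * map_poly cnj q"
  by (rule poly_eqI) (simp add: coeff_map_poly coeff_mult)

lemma map_poly_cnj_of_real: "map_poly cnj (map_poly of_real p) = map_poly of_real p"
  by (rule poly_eqI) (simp add: coeff_map_poly)

lemma inj_map_poly_of_real:
  "map_poly of_real p = (map_poly of_real q :: complex poly) \<Longrightarrow> p = q"
  by (metis (no_types, lifting) coeff_map_poly of_real_0 of_real_eq_iff poly_eqI)

section \<open>Gelfand-Mazur for real normed fields\<close>

text \<open>This is the value at \<open>c\<close> of (X - z)(X - cnj z). Its coefficients are real,
  so it can be evaluated in \<open>'k\<close> although \<open>z\<close> itself need not lie
  there.\<close>

definition conj_quadratic :: "'k::real_normed_field \<Rightarrow> complex \<Rightarrow> 'k" where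
  "conj_quadratic c z = c\<^sup>2 - of_real (2 * Re z) * c + of_real ((cmod z)\<^sup>2)"

text \<open>Completing the square: with \<open>Re z\<close> fixed, enlarging the square of
  \<open>Im z\<close> adds a positive real to the value.\<close>

lemma conj_quadratic_eq: "conj_quadratic c z = (c - of_real (Re z))\<^sup>2 + of_real ((Im z)\<^sup>2)"
  unfolding conj_quadratic_def cmod_power2 by (simp add: power2_eq_square algebra_simps)

lemma conj_quadratic_poly:
  "conj_quadratic c z = poly (map_poly of_real [:(cmod z)\<^sup>2, - 2 * Re z, 1:]) c"
  by (simp add: conj_quadratic_def map_poly_pCons power2_eq_square algebra_simps)

lemma linear_factor_mult_cnj:
  "[:- z, 1:] * [:- cnj z, 1:] = map_poly of_real [:(cmod z)\<^sup>2, - 2 * Re z, 1:]"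
  unfolding cmod_power2 by (simp add: map_poly_pCons complex_eq_iff power2_eq_square)

text \<open>Pairing each linear factor with its conjugate makes the product of a complex polynomial
  and its conjugate a product of real quadratics. It can thus be evaluated at \<open>c\<close>, and
  every pair contributes a factor of norm at least \<open>m\<close>.\<close>

lemma conj_quadratic_prod:
  fixes c :: "'k::real_normed_field"
  assumes "\<And>z. norm (conj_quadratic c z) \<ge> m" "m \<ge> 0"
  shows "\<exists>q. map_poly of_real q = (\<Prod>z\<in>#A. [:- z, 1:]) * map_poly cnj (\<Prod>z\<in>#A. [:- z, 1:])
           \<and> norm (poly (map_poly of_real q) c) \<ge> m ^ size A"
proof (induction A)
  case empty
  show ?case by (rule exI[of _ 1]) (simp add: map_poly_1')
next
  case (add z A)
  let ?P = "\<Prod>z\<in>#A. [:- z, 1:]"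
  let ?Q = "[:(cmod z)\<^sup>2, - 2 * Re z, 1:]"
  obtain q where q: "map_poly of_real q = ?P * map_poly cnj ?P"
    and le: "norm (poly (map_poly of_real q) c) \<ge> m ^ size A"
    using add by blast
  have "map_poly of_real (?Q * q) = ([:- z, 1:] * [:- cnj z, 1:]) * (?P * map_poly cnj ?P)"
    by (simp only: map_poly_of_real_mult q linear_factor_mult_cnj)
  also have "\<dots> = ([:- z, 1:] * ?P) * map_poly cnj ([:- z, 1:] * ?P)"
    by (simp only: map_poly_cnj_mult) (simp add: map_poly_pCons mult_ac del: mult_pCons_left mult_pCons_right)
  finally have "map_poly of_real (?Q * q) = \<dots>" .
  moreover have "norm (poly (map_poly of_real (?Q * q)) c) \<ge> m * m ^ size A"
    unfolding map_poly_of_real_mult poly_mult norm_mult conj_quadratic_poly[symmetric]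
    using assms le by (intro mult_mono) auto
  ultimately show ?case by (intro exI[of _ "?Q * q"]) (simp del: mult_pCons_left)
qed

lemma norm_poly_ge_of_conj_quadratic:
  fixes c :: "'k::real_normed_field"
  assumes "\<And>z. norm (conj_quadratic c z) \<ge> m" "m \<ge> 0" "lead_coeff p = 1"
  shows "(norm (poly (map_poly of_real p) c))\<^sup>2 \<ge> m ^ degree p"
proof -
  let ?p = "map_poly of_real p :: complex poly"
  have deg: "degree ?p = degree p"
    by (rule map_poly_degree_eq) (use assms in auto)
  have "lead_coeff ?p = 1"
    using deg assms by (simp add: coeff_map_poly)
  moreover from this have "?p \<noteq> 0" by auto
  ultimately obtain A where A: "size A = degree p" "?p = (\<Prod>z\<in>#A. [:- z, 1:])"
    using alg_closed_imp_factorization[of ?p] deg by auto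
  obtain q where q: "map_poly of_real q = ?p * map_poly cnj ?p"
    "norm (poly (map_poly of_real q) c) \<ge> m ^ degree p"
    using conj_quadratic_prod[of m c A] assms A by metis
  \<comment> \<open>A real polynomial equals its own conjugate. Passing to the square of
    \<open>p\<close> avoids having to match the nonreal roots of \<open>p\<close> in pairs.\<close>
  have "q = p * p"
    by (rule inj_map_poly_of_real) (simp add: q map_poly_cnj_of_real map_poly_of_real_mult)
  with q(2) show ?thesis
    by (simp add: map_poly_of_real_mult norm_mult power2_eq_square)
qed

text \<open>Outside the disc of radius \<open>3 * norm c\<close> the constant term dominates, and
  the norm is at least its value at \<open>z = 0\<close>, which is the square of
  \<open>norm c\<close>. A minimum over the compact disc is therefore global.\<close>

lemma conj_quadratic_attains_min:
  fixes c :: "'k::real_normed_field"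
  obtains z0 where "\<And>z. norm (conj_quadratic c z0) \<le> norm (conj_quadratic c z)"
proof -
  let ?C = "norm c" and ?f = "\<lambda>z. norm (conj_quadratic c z)"
  have "continuous_on (cball 0 (3 * ?C)) ?f"
    unfolding conj_quadratic_def by (intro continuous_intros)
  then have "\<exists>z0\<in>cball 0 (3 * ?C). \<forall>z\<in>cball 0 (3 * ?C). ?f z0 \<le> ?f z"
    by (intro continuous_attains_inf) auto
  then obtain z0 where z0: "\<And>z. cmod z \<le> 3 * ?C \<Longrightarrow> ?f z0 \<le> ?f z"
    by (metis mem_cball_0)
  have "?f z0 \<le> ?f z" if "cmod z > 3 * ?C" for z
  proof -
    have "norm (of_real ((cmod z)\<^sup>2) :: 'k) \<le> ?f z + norm (of_real (2 * Re z) * c) + norm (c\<^sup>2)"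
      using norm_triangle_ineq[of "conj_quadratic c z" "of_real (2 * Re z) * c - c\<^sup>2"]
        norm_triangle_ineq4[of "of_real (2 * Re z) * c" "c\<^sup>2"]
      unfolding conj_quadratic_def by (simp del: of_real_mult of_real_power)
    also have "norm (of_real (2 * Re z) * c) \<le> 2 * cmod z * ?C"
      unfolding norm_mult norm_of_real using abs_Re_le_cmod[of z] by (intro mult_right_mono) auto
    finally have *: "(cmod z)\<^sup>2 \<le> ?f z + 2 * cmod z * ?C + ?C\<^sup>2"
      by (simp add: norm_power)
    have "3 * ?C * ?C \<le> cmod z * (cmod z - 2 * ?C)"
      using that by (intro mult_mono) auto
    then have "3 * ?C\<^sup>2 + 2 * cmod z * ?C \<le> (cmod z)\<^sup>2"
      by (simp add: power2_eq_square algebra_simps)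
    then have "?C\<^sup>2 \<le> ?f z"
      using * zero_le_power2[of ?C] by linarith
    moreover have "?f z0 \<le> ?C\<^sup>2"
      using z0[of 0] by (simp add: conj_quadratic_def norm_power)
    ultimately show ?thesis by simp
  qed
  with z0 show ?thesis by (meson that not_le)
qed

lemma norm_add_of_real_le_min:
  fixes c :: "'k::real_normed_field"
  assumes min: "\<And>z. norm (conj_quadratic c z) \<ge> m" and "0 < \<epsilon>" "\<epsilon> < m"
    and eq: "norm (conj_quadratic c z) = m"
  shows "norm (conj_quadratic c z + of_real \<epsilon>) \<le> m"
proof -
  have m: "m > 0" using assms by simp
  let ?u = "conj_quadratic c z"
  define U where "U = [:(cmod z)\<^sup>2, - 2 * Re z, 1:]"
  have U: "degree U = 2" "lead_coeff U = 1" by (auto simp: U_def)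
  have u: "poly (map_poly of_real U) c = ?u" by (simp only: conj_quadratic_poly U_def)
  have bound: "norm (?u + of_real \<epsilon>) \<le> m * (1 + (\<epsilon> / m) ^ Suc n)" for n
  proof -
    \<comment> \<open>The geometric sum: the cofactor of \<open>U - (- \<epsilon>)\<close> in the
      difference of the powers with exponent \<open>Suc n\<close>.\<close>
    define V where "V = (\<Sum>i<Suc n. [:- \<epsilon>:] ^ (n - i) * U ^ i)"
    have factor: "U ^ Suc n + - ([:- \<epsilon>:] ^ Suc n) = (U + [:\<epsilon>:]) * V"
      using power_diff_sumr2[of U "Suc n" "[:- \<epsilon>:]"] unfolding V_def by simp
    have degU: "degree (U ^ Suc n) = 2 * Suc n"
      using U by (subst degree_power_eq) auto
    have const: "[:- \<epsilon>:] ^ Suc n = [:(- \<epsilon>) ^ Suc n:]"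
      by (rule poly_const_pow)
    \<comment> \<open>The exponent \<open>Suc n\<close> is positive, so the subtracted constant
      cannot affect the leading coefficient; hence \<open>V\<close> is monic of degree
      \<open>2 * n\<close>.\<close>
    have less: "degree (- ([:- \<epsilon>:] ^ Suc n)) < degree (U ^ Suc n)"
      unfolding degU const by simp
    have "lead_coeff (U ^ Suc n + - ([:- \<epsilon>:] ^ Suc n)) = 1"
      using lead_coeff_add_le[OF less] U(2) by (simp only: add.commute lead_coeff_power power_one)
    moreover have "lead_coeff (U + [:\<epsilon>:]) = 1" by (simp add: U_def)
    ultimately have leadV: "lead_coeff V = 1" unfolding factor lead_coeff_mult by simp
    have "2 * Suc n = degree ((U + [:\<epsilon>:]) * V)"
      using degree_add_eq_left[OF less] degU factor by simp
    also have "\<dots> = 2 + degree V"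
      using leadV by (subst degree_mult_eq) (auto simp: U_def)
    finally have degV: "degree V = 2 * n" by simp
    have "(m ^ n)\<^sup>2 \<le> (norm (poly (map_poly of_real V) c))\<^sup>2"
      using norm_poly_ge_of_conj_quadratic[OF min _ leadV] m degV by (simp add: power_mult mult.commute)
    then have V: "m ^ n \<le> norm (poly (map_poly of_real V) c)"
      by (rule power2_le_imp_le) simp
    have "poly (map_poly of_real ((U + [:\<epsilon>:]) * V)) c
        = (?u + of_real \<epsilon>) * poly (map_poly of_real V) c"
      by (simp add: map_poly_of_real_mult map_poly_of_real_add u map_poly_pCons)
    moreover have "poly (map_poly of_real (U ^ Suc n + - ([:- \<epsilon>:] ^ Suc n))) c
        = ?u ^ Suc n + of_real (- ((- \<epsilon>) ^ Suc n))"
      unfolding const map_poly_of_real_add map_poly_of_real_power poly_add poly_power u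
      by (simp add: map_poly_pCons)
    ultimately have "norm (?u + of_real \<epsilon>) * norm (poly (map_poly of_real V) c)
        = norm (?u ^ Suc n + of_real (- ((- \<epsilon>) ^ Suc n)))"
      unfolding factor by (metis norm_mult)
    also have "\<dots> \<le> norm (?u ^ Suc n) + norm (of_real (- ((- \<epsilon>) ^ Suc n)) :: 'k)"
      by (rule norm_triangle_ineq)
    also have "\<dots> = m ^ Suc n + \<epsilon> ^ Suc n"
      unfolding norm_power eq norm_of_real using \<open>\<epsilon> > 0\<close> by (simp only: abs_minus_cancel power_abs abs_of_pos)
    also have "\<dots> = (m * (1 + (\<epsilon> / m) ^ Suc n)) * m ^ n"
      using m by (simp add: power_divide field_simps)
    finally have "norm (?u + of_real \<epsilon>) * m ^ n \<le> \<dots>"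
      using V mult_left_mono[OF V, of "norm (?u + of_real \<epsilon>)"] by simp
    then show ?thesis using m by simp
  qed
  have "(\<lambda>n. (\<epsilon> / m) ^ Suc n) \<longlonglongrightarrow> 0"
    using assms m by (intro LIMSEQ_Suc LIMSEQ_power_zero) auto
  then have "(\<lambda>n. m * (1 + (\<epsilon> / m) ^ Suc n)) \<longlonglongrightarrow> m * (1 + 0)"
    by (intro tendsto_intros)
  then show ?thesis
    using bound by (intro LIMSEQ_le_const[of _ m]) auto
qed

lemma conj_quadratic_root:
  fixes c :: "'k::real_normed_field"
  shows "\<exists>z. conj_quadratic c z = 0"
proof (rule ccontr)
  assume nz: "\<not> ?thesis"
  obtain z0 where z0: "\<And>z. norm (conj_quadratic c z0) \<le> norm (conj_quadratic c z)"
    using conj_quadratic_attains_min[of c] by blast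
  define m where "m = norm (conj_quadratic c z0)"
  have m: "m > 0" using nz by (auto simp: m_def)
  have min: "\<And>z. norm (conj_quadratic c z) \<ge> m" using z0 by (simp add: m_def)
  \<comment> \<open>Each step keeps the real part and raises the value by \<open>m / 2\<close>, an
    increment strictly between 0 and \<open>m\<close>.\<close>
  define Z where "Z n = Complex (Re z0) (sqrt ((Im z0)\<^sup>2 + n * (m / 2)))" for n :: nat
  have Z: "conj_quadratic c (Z n) = (c - of_real (Re z0))\<^sup>2 + of_real ((Im z0)\<^sup>2 + n * (m / 2))" for n
    unfolding conj_quadratic_eq Z_def using m by simp
  have eq: "norm (conj_quadratic c (Z n)) = m" for n
  proof (induction n)
    case 0
    show ?case unfolding Z by (simp add: m_def conj_quadratic_eq)
  next
    case (Suc n)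
    have "conj_quadratic c (Z (Suc n)) = conj_quadratic c (Z n) + of_real (m / 2)"
      unfolding Z by (simp add: algebra_simps add_divide_distrib)
    then have "norm (conj_quadratic c (Z (Suc n))) \<le> m"
      using norm_add_of_real_le_min[OF min _ _ Suc, of "m / 2"] m by simp
    with min show ?case by (simp add: antisym)
  qed
  obtain n :: nat where n: "n * (m / 2) > m + norm ((c - of_real (Re z0))\<^sup>2)"
    using m reals_Archimedean3[of "m / 2"] half_gt_zero by blast
  have "n * (m / 2) \<le> norm (of_real ((Im z0)\<^sup>2 + n * (m / 2)) :: 'k)"
    unfolding norm_of_real using m by simp
  also have "\<dots> \<le> norm (conj_quadratic c (Z n)) + norm ((c - of_real (Re z0))\<^sup>2)"
    unfolding Z using norm_triangle_ineq4[of "conj_quadratic c (Z n)" "(c - of_real (Re z0))\<^sup>2"]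
    unfolding Z by simp
  finally show False using n eq by simp
qed

text \<open>The part of Gelfand-Mazur needed below: dimension at most 2 over the reals. If all
  elements are real, any \<open>j\<close> serves; otherwise a nonreal element is normalised to a
  square root of -1.\<close>

theorem real_normed_field_two_generators:
  "\<exists>j::'k::real_normed_field. \<forall>c. \<exists>s t. c = of_real s + of_real t * j"
proof (cases "\<forall>c::'k. \<exists>s. c = of_real s")
  case True
  then show ?thesis by (metis add.right_neutral mult_zero_left of_real_0)
next
  case False
  then obtain c0 :: 'k where c0: "\<And>s. c0 \<noteq> of_real s" by blast
  have root: "\<exists>a b. (c - of_real a)\<^sup>2 = - of_real (b\<^sup>2)" for c :: 'k
    using conj_quadratic_root[of c] unfolding conj_quadratic_eq by (metis eq_neg_iff_add_eq_0)
  obtain a0 b0 where ab: "(c0 - of_real a0)\<^sup>2 = - of_real (b0\<^sup>2)" using root by blast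
  have b0: "b0 \<noteq> 0" using ab c0[of a0] by auto
  define j where "j = (c0 - of_real a0) / of_real b0"
  have j: "j\<^sup>2 = - 1" using ab b0 by (simp add: j_def power_divide)
  \<comment> \<open>After a real shift, \<open>c\<close> has the same square as a real multiple of
    \<open>j\<close>, and square roots in a field are unique up to sign.\<close>
  have "\<exists>s t. c = of_real s + of_real t * j" for c
  proof -
    obtain a b where "(c - of_real a)\<^sup>2 = - of_real (b\<^sup>2)" using root by blast
    also have "\<dots> = (of_real b * j)\<^sup>2" by (simp add: power_mult_distrib j)
    finally have "c - of_real a = of_real b * j \<or> c - of_real a = - (of_real b * j)"
      by (simp only: power2_eq_iff)
    then have "c = of_real a + of_real b * j \<or> c = of_real a + of_real (- b) * j"
      by (auto simp: diff_eq_eq)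
    then show ?thesis by blast
  qed
  then show ?thesis by blast
qed

section \<open>Closedness of finite-dimensional extensions, over the reals\<close>

text \<open>A vector outside \<open>S\<close> has positive distance from \<open>S\<close>, which
  bounds its coefficient in x by a multiple of \<open>norm x\<close>. Near a limit point only a
  compact interval of coefficients occurs, and a closed set plus a compact set is closed.\<close>

lemma closed_span_insert:
  fixes S :: "'a::real_normed_vector set"
  assumes S: "subspace S" "closed S"
  shows "closed (span (insert v S))"
proof (cases "v \<in> S")
  case True
  then show ?thesis using S by (simp add: insert_absorb span_eq_iff[THEN iffD2])
next
  case False
  define d where "d = infdist v S"
  have S0: "0 \<in> S" using S subspace_0 by blast
  then have d: "d > 0"
    unfolding d_def using False S by (intro infdist_pos_not_in_closed) auto
  have le: "\<bar>r\<bar> * d \<le> norm x" if "x - r *\<^sub>R v \<in> S" for x r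
  proof (cases "r = 0")
    case False
    have "(- 1 / r) *\<^sub>R (x - r *\<^sub>R v) \<in> S" using that S subspace_scale by blast
    then have "v - (1 / r) *\<^sub>R x \<in> S" using False by (simp add: algebra_simps)
    then have "d \<le> dist v (v - (1 / r) *\<^sub>R x)" unfolding d_def by (rule infdist_le)
    then show ?thesis using False by (simp add: dist_norm field_simps)
  qed simp
  have mem: "x \<in> span (insert v S) \<longleftrightarrow> (\<exists>r. x - r *\<^sub>R v \<in> S)" for x
    using S by (simp add: span_insert span_eq_iff[THEN iffD2])
  show ?thesis
  proof (rule closed_limpt[THEN iffD2, rule_format], rule ccontr)
    fix w assume w: "w islimpt span (insert v S)" and nw: "w \<notin> span (insert v S)"
    \<comment> \<open>Approximants within distance 1 of \<open>w\<close> have norm at most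
      \<open>norm w + 1\<close>, so \<open>le\<close> bounds their coefficients by
      \<open>R\<close>.\<close>
    define R where "R = (norm w + 1) / d"
    let ?K = "(\<lambda>r. r *\<^sub>R v) ` {- R..R}"
    have "compact ?K" by (intro compact_continuous_image continuous_intros) auto
    then have cl: "closed (\<Union>x\<in>S. \<Union>y\<in>?K. {x + y})" (is "closed ?T")
      using S closed_compact_sums by blast
    have "w \<in> closure ?T"
      unfolding closure_approachable
    proof (intro allI impI)
      fix e :: real assume "e > 0"
      then obtain x where x: "x \<in> span (insert v S)" "dist x w < min e 1"
        using w unfolding islimpt_approachable by (metis min_less_iff_conj zero_less_one)
      obtain r where r: "x - r *\<^sub>R v \<in> S" using x mem by blast
      have "norm x \<le> norm w + 1"
        using x(2) norm_triangle_ineq2[of x w] by (simp add: dist_norm)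
      with le[OF r] have "\<bar>r\<bar> \<le> R" using d by (simp add: R_def field_simps)
      then have "r *\<^sub>R v \<in> ?K" by (intro imageI) auto
      with r have "(x - r *\<^sub>R v) + r *\<^sub>R v \<in> ?T" by blast
      then show "\<exists>y\<in>?T. dist y w < e" using x by (intro bexI[of _ x]) auto
    qed
    then have "w \<in> ?T" using cl by simp
    then obtain x r where "x \<in> S" "w = x + r *\<^sub>R v" by blast
    then have "w - r *\<^sub>R v \<in> S" by simp
    with nw mem show False by blast
  qed
qed

lemma closed_span_Un_finite:
  fixes S :: "'a::real_normed_vector set"
  assumes "subspace S" "closed S" "finite B"
  shows "closed (span (S \<union> B))"
  using assms(3)
proof induction
  case empty
  then show ?case using assms by (simp add: span_eq_iff[THEN iffD2])
next
  case (insert b B)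
  have "span (insert b (span (S \<union> B))) = span (S \<union> insert b B)"
    by (auto simp: span_insert span_span)
  then show ?case using closed_span_insert[OF subspace_span insert.IH, of b] by simp
qed

section \<open>Finite-dimensional extensions of half-spaces\<close>

context banach_space_over
begin

lemma finite_dim_subspace_subset:
  assumes "finite_dim_subspace V" "subspace U" "U \<subseteq> V"
  shows "finite_dim_subspace U"
proof -
  obtain B where B: "finite B" "V = span B"
    using assms(1) unfolding finite_dim_subspace_def by blast
  obtain C where C: "C \<subseteq> U" "independent C" "U \<subseteq> span C"
    using maximal_independent_subset by blast
  have "finite C" using independent_span_bound[OF B(1) C(2)] B C assms by blast
  moreover have "U = span C" using C assms span_minimal by blast
  ultimately show ?thesis unfolding finite_dim_subspace_def by blast
qed

lemma subspace_imp_real_subspace: "subspace V \<Longrightarrow> Real_Vector_Spaces.subspace V"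
  unfolding Real_Vector_Spaces.subspace_def
  using subspace_0 subspace_add subspace_scale scale_of_real by metis

lemma closed_span_Un_finite_set:
  assumes Y: "subspace Y" "closed Y" and B: "finite B"
  shows "closed (span (Y \<union> B))"
proof -
  obtain j :: 'k where j: "\<And>c. \<exists>s t. c = of_real s + of_real t * j"
    using real_normed_field_two_generators by blast
  let ?R = "Real_Vector_Spaces.span (Y \<union> (B \<union> scale j ` B))"
  have scale_j: "scale (of_real s + of_real t * j) x = s *\<^sub>R x + t *\<^sub>R scale j x" for s t x
    by (simp only: scale_left_distrib scale_of_real flip: scale_scale)
  have "?R \<subseteq> span (Y \<union> B)"
  proof (rule Real_Vector_Spaces.span_minimal)
    show "Y \<union> (B \<union> scale j ` B) \<subseteq> span (Y \<union> B)"
      by (auto intro: span_base span_scale)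
  qed (intro subspace_imp_real_subspace subspace_span)
  moreover have "span (Y \<union> B) \<subseteq> ?R"
  proof
    fix x assume "x \<in> span (Y \<union> B)"
    then obtain y z where yz: "x = y + z" "y \<in> Y" "z \<in> span B"
      using Y span_eq_iff[THEN iffD2] unfolding span_Un by blast
    from yz(3) have "z \<in> ?R"
    proof (induction rule: span_induct_alt)
      case base
      show ?case by (rule Real_Vector_Spaces.span_zero)
    next
      case (step c b w)
      obtain s t where c: "c = of_real s + of_real t * j" using j by blast
      show ?case unfolding c scale_j using step
        by (intro Real_Vector_Spaces.span_add Real_Vector_Spaces.span_scale)
          (auto intro: Real_Vector_Spaces.span_base)
    qed
    then show "x \<in> ?R"
      using yz by (auto intro: Real_Vector_Spaces.span_add Real_Vector_Spaces.span_base)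
  qed
  moreover have "closed ?R"
    using Y B by (intro closed_span_Un_finite subspace_imp_real_subspace) auto
  ultimately show ?thesis by simp
qed

lemma half_space_span_Un_finite:
  assumes Y: "half_space Y" and B: "finite B"
  shows "half_space (span (Y \<union> B))"
proof -
  have sub: "subspace Y" "closed Y" using Y unfolding half_space_def by auto
  have spanY: "span Y = Y" using sub by (simp add: span_eq_iff)
  have "\<not> finite_dim_subspace (span (Y \<union> B))"
    using finite_dim_subspace_subset[OF _ sub(1)] Y span_superset unfolding half_space_def by blast
  moreover have "\<not> finite_codim (span (Y \<union> B))"
  proof
    assume "finite_codim (span (Y \<union> B))"
    then obtain C where C: "finite C" "\<And>x. \<exists>b\<in>span C. x - b \<in> span (Y \<union> B)"
      unfolding finite_codim_def by blast
    \<comment> \<open>Representatives modulo the extension become representatives modulo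
      \<open>Y\<close> once the vectors of \<open>B\<close> are adjoined to
      \<open>C\<close>.\<close>
    have "\<exists>b\<in>span (C \<union> B). x - b \<in> Y" for x
    proof -
      obtain b where b: "b \<in> span C" "x - b \<in> span (Y \<union> B)" using C by blast
      then obtain y z where yz: "x - b = y + z" "y \<in> Y" "z \<in> span B"
        unfolding span_Un spanY by blast
      have "b + z \<in> span (C \<union> B)" using b yz unfolding span_Un by blast
      moreover have "x - (b + z) = y" using yz(1) by (simp add: algebra_simps)
      ultimately show ?thesis using yz(2) by metis
    qed
    then have "finite_codim Y" unfolding finite_codim_def using C(1) B by blast
    then show False using Y unfolding half_space_def by blast
  qed
  ultimately show ?thesis
    using closed_span_Un_finite_set[OF sub B] unfolding half_space_def by blast
qed

text \<open>By the modular law, Z = Y + (Z \<inter> F), and the second summand has a finite spanning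
  set.\<close>

lemma half_space_between:
  assumes Y: "half_space Y" and F: "finite_dim_subspace F"
    and Z: "subspace Z" "Y \<subseteq> Z" "Z \<subseteq> Y + F"
  shows "half_space Z"
proof -
  have sub: "subspace Y" using Y unfolding half_space_def by auto
  have "subspace F" using F unfolding finite_dim_subspace_def by (auto intro: subspace_span)
  then have "finite_dim_subspace (Z \<inter> F)"
    using finite_dim_subspace_subset[OF F] Z subspace_inter by blast
  then obtain B where B: "finite B" "Z \<inter> F = span B"
    unfolding finite_dim_subspace_def by blast
  have "Z = span (Y \<union> B)"
  proof
    show "span (Y \<union> B) \<subseteq> Z"
      using Z B span_superset by (intro span_minimal) blast+
    show "Z \<subseteq> span (Y \<union> B)"
    proof
      fix x assume x: "x \<in> Z"
      then obtain y f where yf: "x = y + f" "y \<in> Y" "f \<in> F"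
        using Z(3) unfolding set_plus_def by blast
      have "f = x - y" using yf by simp
      then have "f \<in> Z \<inter> F" using x yf Z subspace_diff by blast
      then show "x \<in> span (Y \<union> B)"
        unfolding span_Un using B yf span_base by blast
    qed
  qed
  then show ?thesis using half_space_span_Un_finite[OF Y B(1)] by simp
qed

end

section \<open>The invariant half-space\<close>

theorem proposition2p2:
  fixes scale :: "'k::real_normed_field \<Rightarrow> 'x::banach \<Rightarrow> 'x"
    and Y :: "'x set" and A :: "('x \<Rightarrow> 'x) set"
  assumes "banach_space_over scale"
    and "banach_space_over.half_space scale Y"
    and "banach_space_over.operator_algebra scale A"
    and "\<exists>F. banach_space_over.finite_dim_subspace scale F \<and> (\<forall>T\<in>A. T ` Y \<subseteq> Y + F)"
  shows "\<exists>Z. banach_space_over.half_space scale Z \<and>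
             (\<forall>T\<in>A. invariant_under T Z)"
proof -
  interpret banach_space_over scale by fact
  obtain F where F: "finite_dim_subspace F" and TF: "\<And>T. T \<in> A \<Longrightarrow> T ` Y \<subseteq> Y + F"
    using assms(4) by blast
  have Y: "subspace Y" using assms(2) unfolding half_space_def by blast
  have subF: "subspace F" using F unfolding finite_dim_subspace_def by (auto intro: subspace_span)
  \<comment> \<open>\<open>Y\<close> is included explicitly because \<open>A\<close> may lack the
    identity, and the span must contain \<open>Y\<close> to be a half-space between \<open>Y\<close>
    and \<open>Y + F\<close>.\<close>
  let ?G = "Y \<union> (\<Union>T\<in>A. T ` Y)"
  have "subspace (Y + F)"
    using subspace_sums[OF Y subF] unfolding set_plus_def by (simp add: Bex_def conj_ac)
  moreover have "Y \<subseteq> Y + F" using subspace_0[OF subF] set_zero_plus2[of F Y] by (simp add: add.commute)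
  ultimately have "span ?G \<subseteq> Y + F" using TF by (intro span_minimal) auto
  then have "half_space (span ?G)"
    using span_superset[of ?G] by (intro half_space_between[OF assms(2) F]) auto
  moreover have "invariant_under S (span ?G)" if S: "S \<in> A" for S
  proof -
    have lin: "Vector_Spaces.linear scale scale S"
      using S assms(3) unfolding operator_algebra_def bounded_operators_def by blast
    then interpret S: Vector_Spaces.linear scale scale S .
    have comp: "S \<circ> T \<in> A" if "T \<in> A" for T
      using S assms(3) that unfolding operator_algebra_def by blast
    have "S ` ?G \<subseteq> ?G"
    proof (intro image_subsetI, elim UnE UN_E imageE)
      fix x assume "x \<in> Y"
      then show "S x \<in> ?G" using S by blast
    next
      fix x T y assume "T \<in> A" "x = T y" "y \<in> Y"
      moreover from this have "S x = (S \<circ> T) y" by simp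
      ultimately show "S x \<in> ?G" using comp by blast
    qed
    then have "span (S ` ?G) \<subseteq> span ?G" by (rule span_mono)
    then show ?thesis unfolding invariant_under_def S.span_image .
  qed
  ultimately show ?thesis by blast
qed

end
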